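(* Let $\mathbb{F}$ be a field, $k\ge1$, $n=2k+1$, let $H_n$ be the Heisenberg algebra over $\mathbb{F}$ with basis $\{e_1,\hat e_1,\dots,e_k,\hat e_k,z\}$, and let $\Gamma$ be the fine grading on $H_n$ whose homogeneous components are $\langle z\rangle,\langle e_i\rangle,\langle\hat e_i\rangle$ ($1\le i\le k$). Then the Weyl group $\mathcal{W}(\Gamma)$ is generated by $\{[\tilde\sigma]:\sigma\in S_k\}$ and $[\mu_1]$.
   Context: The Heisenberg algebra $H_n$, $n=2k+1$, is the Lie algebra with basis $\{e_1,\hat e_1,\dots,e_k,\hat e_k,z\}$ whose only nonzero products are $[e_i,\hat e_i]=-[\hat e_i,e_i]=z$, $1\le i\le k$. The grading $\Gamma$ is a $\mathbb{Z}^{k+1}$-grading: $\deg z=(0,\dots,0;2)$, $\deg e_i=(0,\dots,1,\dots,0;1)$, $\deg\hat e_i=(0,\dots,-1,\dots,0;1)$ ($\pm1$ in the $i$-th slot). For a grading $\Gamma$ on an algebra $A$, $\mathrm{Aut}(\Gamma)$ is the group of automorphisms of $A$ that permute the homogeneous components of $\Gamma$, $\mathrm{Stab}(\Gamma)$ is the subgroup of automorphisms of $A$ leaving each homogeneous component invariant, and the Weyl group is $\mathcal{W}(\Gamma)=\mathrm{Aut}(\Gamma)/\mathrm{Stab}(\Gamma)$. The class of $f\in\mathrm{Aut}(\Gamma)$ in $\mathcal{W}(\Gamma)$ is denoted $[f]$. For $\sigma\in S_k$, $\tilde\sigma\in\mathrm{Aut}(\Gamma)$ is given by $\tilde\sigma(e_i)=e_{\sigma(i)}$,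 $\tilde\sigma(\hat e_i)=\hat e_{\sigma(i)}$, $\tilde\sigma(z)=z$. For $i\le k$, $\mu_i\in\mathrm{Aut}(\Gamma)$ is given by $\mu_i(e_i)=\hat e_i$, $\mu_i(\hat e_i)=-e_i$, $\mu_i(e_j)=e_j$ and $\mu_i(\hat e_j)=\hat e_j$ for $j\ne i$, $\mu_i(z)=z$. *)

theory Defs
  imports
    "HOL-Analysis.Cartesian_Space"
    "HOL-Library.Product_Plus"
    "HOL-Combinatorics.Permutations"
    "HOL-Algebra.Bij"
    "HOL-Algebra.Coset"
    "HOL-Algebra.Generated_Groups"
begin

section \<open>The Weyl group of a grading\<close>

text \<open>
  A (not necessarily associative) algebra structure on the coordinate space \<^typ>\<open>'a::field ^ 'b::finite\<close>
  is given by its product \<open>br\<close>. A grading is given by the family \<open>\<Gamma>\<close> of its homogeneous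
  components, indexed by the degrees; \<open>\<Gamma> g = {0}\<close> for degrees \<open>g\<close> outside the support.
\<close>

definition alg_auts ::
  "(('a::field ^ 'b::finite) \<Rightarrow> ('a ^ 'b) \<Rightarrow> ('a ^ 'b)) \<Rightarrow> (('a ^ 'b) \<Rightarrow> ('a ^ 'b)) set"
  where "alg_auts br =
    {f. Vector_Spaces.linear (*s) (*s) f \<and> bij f \<and> (\<forall>x y. f (br x y) = br (f x) (f y))}"

definition hom_components :: "('g \<Rightarrow> ('a::field ^ 'b::finite) set) \<Rightarrow> ('a ^ 'b) set set"
  where "hom_components \<Gamma> = {\<Gamma> g | g. \<Gamma> g \<noteq> {0}}"

definition aut_grading ::
  "(('a::field ^ 'b::finite) \<Rightarrow> ('a ^ 'b) \<Rightarrow> ('a ^ 'b)) \<Rightarrow> ('g \<Rightarrow> ('a ^ 'b) set)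
    \<Rightarrow> (('a ^ 'b) \<Rightarrow> ('a ^ 'b)) set"
  where "aut_grading br \<Gamma> =
    {f \<in> alg_auts br. bij_betw ((`) f) (hom_components \<Gamma>) (hom_components \<Gamma>)}"

definition stab_grading ::
  "(('a::field ^ 'b::finite) \<Rightarrow> ('a ^ 'b) \<Rightarrow> ('a ^ 'b)) \<Rightarrow> ('g \<Rightarrow> ('a ^ 'b) set)
    \<Rightarrow> (('a ^ 'b) \<Rightarrow> ('a ^ 'b)) set"
  where "stab_grading br \<Gamma> = {f \<in> alg_auts br. \<forall>g. f ` \<Gamma> g = \<Gamma> g}"

definition aut_group ::
  "(('a::field ^ 'b::finite) \<Rightarrow> ('a ^ 'b) \<Rightarrow> ('a ^ 'b)) \<Rightarrow> ('g \<Rightarrow> ('a ^ 'b) set)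
    \<Rightarrow> (('a ^ 'b) \<Rightarrow> ('a ^ 'b)) monoid"
  where "aut_group br \<Gamma> = BijGroup UNIV \<lparr>carrier := aut_grading br \<Gamma>\<rparr>"

definition weyl_group ::
  "(('a::field ^ 'b::finite) \<Rightarrow> ('a ^ 'b) \<Rightarrow> ('a ^ 'b)) \<Rightarrow> ('g \<Rightarrow> ('a ^ 'b) set)
    \<Rightarrow> (('a ^ 'b) \<Rightarrow> ('a ^ 'b)) set monoid"
  where "weyl_group br \<Gamma> = aut_group br \<Gamma> Mod stab_grading br \<Gamma>"

definition weyl_class ::
  "(('a::field ^ 'b::finite) \<Rightarrow> ('a ^ 'b) \<Rightarrow> ('a ^ 'b)) \<Rightarrow> ('g \<Rightarrow> ('a ^ 'b) set)
    \<Rightarrow> (('a ^ 'b) \<Rightarrow> ('a ^ 'b)) \<Rightarrow> (('a ^ 'b) \<Rightarrow> ('a ^ 'b)) set"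
  where "weyl_class br \<Gamma> f = stab_grading br \<Gamma> #>\<^bsub>aut_group br \<Gamma>\<^esub> f"

lemma mult_aut_group:
  "bij f \<Longrightarrow> bij h \<Longrightarrow> mult (aut_group br \<Gamma>) f h = f \<circ> h"
  by (auto simp: aut_group_def BijGroup_def Bij_def compose_def)

lemma aut_grading_bij: "f \<in> aut_grading br \<Gamma> \<Longrightarrow> bij f"
  by (auto simp: aut_grading_def alg_auts_def)

lemma id_alg_auts: "id \<in> alg_auts br"
  using vec.linear_id by (auto simp: alg_auts_def)

lemma comp_alg_auts:
  assumes "f \<in> alg_auts br" "h \<in> alg_auts br"
  shows "f \<circ> h \<in> alg_auts br"
  using assms unfolding alg_auts_def
  by (auto intro: bij_comp Vector_Spaces.linear_compose)

lemma inv_alg_auts: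
  assumes "f \<in> alg_auts br"
  shows "inv_into UNIV f \<in> alg_auts br"
proof -
  have b: "bij f" and l: "Vector_Spaces.linear (*s) (*s) f"
    and h: "\<And>x y. f (br x y) = br (f x) (f y)"
    using assms by (auto simp: alg_auts_def)
  interpret f: Vector_Spaces.linear "(*s)" "(*s)" f by (rule l)
  have s: "f (inv_into UNIV f x) = x" for x using b by (simp add: bij_is_surj surj_f_inv_f)
  have i: "inv_into UNIV f (f x) = x" for x using b by (simp add: bij_is_inj)
  have "Vector_Spaces.linear (*s) (*s) (inv_into UNIV f)"
  proof
    show "inv_into UNIV f (x + y) = inv_into UNIV f x + inv_into UNIV f y" for x y
      by (metis s i f.add)
    show "inv_into UNIV f (r *s x) = r *s inv_into UNIV f x" for r x
      by (metis s i f.scale)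
  qed
  moreover have "inv_into UNIV f (br x y) = br (inv_into UNIV f x) (inv_into UNIV f y)" for x y
    by (metis h s i)
  ultimately show ?thesis using b bij_imp_bij_inv by (auto simp: alg_auts_def)
qed

lemma group_aut_group: "group (aut_group br \<Gamma>)"
proof (rule groupI)
  let ?C = "hom_components \<Gamma>"
  have car: "carrier (aut_group br \<Gamma>) = aut_grading br \<Gamma>" by (simp add: aut_group_def)
  have one: "one (aut_group br \<Gamma>) = id" by (auto simp: aut_group_def BijGroup_def)
  note m = mult_aut_group[OF aut_grading_bij aut_grading_bij]
  have cl: "f \<circ> h \<in> aut_grading br \<Gamma>" if "f \<in> aut_grading br \<Gamma>" "h \<in> aut_grading br \<Gamma>" for f h
  proof -
    have "bij_betw ((`) f \<circ> (`) h) ?C ?C"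
      using that by (auto simp: aut_grading_def intro: bij_betw_trans)
    moreover have "(`) f \<circ> (`) h = (`) (f \<circ> h)" by (auto simp: fun_eq_iff)
    ultimately show ?thesis using that comp_alg_auts by (auto simp: aut_grading_def)
  qed
  show "one (aut_group br \<Gamma>) \<in> carrier (aut_group br \<Gamma>)"
    using id_alg_auts by (auto simp: one car aut_grading_def bij_betw_def)
  show "mult (aut_group br \<Gamma>) f h \<in> carrier (aut_group br \<Gamma>)"
    if "f \<in> carrier (aut_group br \<Gamma>)" "h \<in> carrier (aut_group br \<Gamma>)" for f h
    using that cl by (simp add: car m)
  show "mult (aut_group br \<Gamma>) (mult (aut_group br \<Gamma>) f h) j
      = mult (aut_group br \<Gamma>) f (mult (aut_group br \<Gamma>) h j)"
    if "f \<in> carrier (aut_group br \<Gamma>)" "h \<in> carrier (aut_group br \<Gamma>)"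
      "j \<in> carrier (aut_group br \<Gamma>)" for f h j
    using that cl[of f h] cl[of h j] by (simp add: car m comp_assoc)
  show "mult (aut_group br \<Gamma>) (one (aut_group br \<Gamma>)) f = f"
    if "f \<in> carrier (aut_group br \<Gamma>)" for f
    using that by (simp add: car one mult_aut_group aut_grading_bij)
  show "\<exists>h\<in>carrier (aut_group br \<Gamma>). mult (aut_group br \<Gamma>) h f = one (aut_group br \<Gamma>)"
    if "f \<in> carrier (aut_group br \<Gamma>)" for f
  proof
    have f: "f \<in> aut_grading br \<Gamma>" "bij f" using that aut_grading_bij by (auto simp: car)
    let ?h = "inv_into UNIV f"
    have i: "?h ` (f ` S) = S" for S
      using f(2) by (simp add: bij_is_inj image_image)
    have im: "(`) f ` ?C = ?C" using f(1) by (simp add: aut_grading_def bij_betw_def)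
    have "(`) ?h ` ?C = (`) ?h ` ((`) f ` ?C)" by (simp only: im)
    also have "\<dots> = (\<lambda>S. ?h ` (f ` S)) ` ?C" by (rule image_image)
    also have "\<dots> = ?C" by (simp only: i image_ident)
    finally have "(`) ?h ` ?C = ?C" .
    moreover have "inj_on ((`) ?h) ?C"
      using f(2) by (meson bij_imp_bij_inv bij_is_inj inj_image_eq_iff inj_onI)
    ultimately show "?h \<in> carrier (aut_group br \<Gamma>)"
      using f(1) inv_alg_auts by (auto simp: car aut_grading_def bij_betw_def)
    show "mult (aut_group br \<Gamma>) ?h f = one (aut_group br \<Gamma>)"
      using f(2) by (simp add: one mult_aut_group bij_imp_bij_inv bij_is_inj)
  qed
qed

lemma stab_normal: "stab_grading br \<Gamma> \<lhd> aut_group br \<Gamma>"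
proof -
  interpret G: group "aut_group br \<Gamma>" by (rule group_aut_group)
  have car: "carrier (aut_group br \<Gamma>) = aut_grading br \<Gamma>" by (simp add: aut_group_def)
  have one: "one (aut_group br \<Gamma>) = id" by (auto simp: aut_group_def BijGroup_def)
  have sb: "f \<in> stab_grading br \<Gamma> \<Longrightarrow> bij f" for f by (auto simp: stab_grading_def alg_auts_def)
  have sub: "stab_grading br \<Gamma> \<subseteq> aut_grading br \<Gamma>"
  proof
    fix f assume f: "f \<in> stab_grading br \<Gamma>"
    have "f ` S = S" if "S \<in> hom_components \<Gamma>" for S
      using that f by (auto simp: stab_grading_def hom_components_def)
    hence "bij_betw ((`) f) (hom_components \<Gamma>) (hom_components \<Gamma>)"
      by (simp add: bij_betw_def inj_on_def)
    thus "f \<in> aut_grading br \<Gamma>" using f by (simp add: stab_grading_def aut_grading_def)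
  qed
  have iv: "m_inv (aut_group br \<Gamma>) f = inv_into UNIV f" if "f \<in> aut_grading br \<Gamma>" for f
  proof -
    have b: "bij f" "bij (m_inv (aut_group br \<Gamma>) f)"
      using that G.inv_closed[of f] aut_grading_bij by (auto simp: car)
    have "m_inv (aut_group br \<Gamma>) f \<circ> f = id"
      using G.l_inv[of f] that b by (simp add: car one mult_aut_group)
    thus ?thesis using b(1) by (metis bij_def inv_unique_comp o_inv_distrib surj_iff comp_assoc comp_id id_comp)
  qed
  have sinv: "inv_into UNIV f \<in> stab_grading br \<Gamma>" if f: "f \<in> stab_grading br \<Gamma>" for f
  proof -
    have "inv_into UNIV f ` \<Gamma> g = \<Gamma> g" for g
    proof -
      have "f ` \<Gamma> g = \<Gamma> g" using f by (simp add: stab_grading_def)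
      hence "inv_into UNIV f ` \<Gamma> g = inv_into UNIV f ` (f ` \<Gamma> g)" by simp
      thus ?thesis using sb[OF f] by (simp add: bij_is_inj image_image)
    qed
    thus ?thesis using f inv_alg_auts by (auto simp: stab_grading_def)
  qed
  have "subgroup (stab_grading br \<Gamma>) (aut_group br \<Gamma>)"
  proof (rule G.subgroupI)
    show "stab_grading br \<Gamma> \<subseteq> carrier (aut_group br \<Gamma>)" using sub by (simp add: car)
    have "id \<in> stab_grading br \<Gamma>" by (simp add: stab_grading_def id_alg_auts)
    thus "stab_grading br \<Gamma> \<noteq> {}" by blast
    show "m_inv (aut_group br \<Gamma>) f \<in> stab_grading br \<Gamma>" if "f \<in> stab_grading br \<Gamma>" for f
      using that sub iv sinv by auto
    show "mult (aut_group br \<Gamma>) f h \<in> stab_grading br \<Gamma>"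
      if "f \<in> stab_grading br \<Gamma>" "h \<in> stab_grading br \<Gamma>" for f h
    proof -
      have "f \<circ> h \<in> stab_grading br \<Gamma>"
        using that by (simp add: stab_grading_def comp_alg_auts del: o_apply image_comp add: image_comp[symmetric])
      thus ?thesis using that by (simp add: mult_aut_group sb)
    qed
  qed
  moreover have "mult (aut_group br \<Gamma>) (mult (aut_group br \<Gamma>) f h) (m_inv (aut_group br \<Gamma>) f)
      \<in> stab_grading br \<Gamma>"
    if f: "f \<in> aut_grading br \<Gamma>" and h: "h \<in> stab_grading br \<Gamma>" for f h
  proof -
    let ?j = "inv_into UNIV f"
    have fb: "bij f" "bij ?j" "bij h" "bij (f \<circ> h)"
      using f h sb aut_grading_bij bij_imp_bij_inv bij_comp by blast+
    have ja: "?j \<in> aut_grading br \<Gamma>" using G.inv_closed[of f] f iv by (simp add: car)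
    have fj: "f ` (?j ` S) = S" for S
      using fb(1) by (simp add: bij_is_surj image_f_inv_f)
    have "(f \<circ> h \<circ> ?j) ` \<Gamma> g = \<Gamma> g" for g
    proof (cases "\<Gamma> g = {0}")
      case True
      have z: "k 0 = 0" if "k \<in> alg_auts br" for k
      proof -
        have "Vector_Spaces.linear (*s) (*s) k" using that by (simp add: alg_auts_def)
        then interpret k: Vector_Spaces.linear "(*s)" "(*s)" k .
        show ?thesis by (rule k.zero)
      qed
      show ?thesis using True z[of f] z[of h] z[of ?j] f h ja
        by (simp add: aut_grading_def stab_grading_def)
    next
      case False
      hence "\<Gamma> g \<in> hom_components \<Gamma>" by (auto simp: hom_components_def)
      hence "?j ` \<Gamma> g \<in> hom_components \<Gamma>"
        using ja by (auto simp: aut_grading_def dest: bij_betwE)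
      then obtain g' where "?j ` \<Gamma> g = \<Gamma> g'" by (auto simp: hom_components_def)
      hence "h ` (?j ` \<Gamma> g) = ?j ` \<Gamma> g" using h by (simp add: stab_grading_def)
      thus ?thesis by (simp only: image_comp[symmetric] fj)
    qed
    hence "f \<circ> h \<circ> ?j \<in> stab_grading br \<Gamma>"
      using f h ja by (simp add: stab_grading_def aut_grading_def comp_alg_auts)
    thus ?thesis using f fb by (simp add: iv mult_aut_group)
  qed
  ultimately show ?thesis by (simp add: G.normal_inv_iff car)
qed

lemma group_weyl_group: "group (weyl_group br \<Gamma>)"
  unfolding weyl_group_def using stab_normal by (rule normal.factorgroup_is_group)


section \<open>The Heisenberg algebra\<close>

text \<open>
  The basis of the Heisenberg algebra \<open>H\<^sub>n\<close> with \<open>n = 2 * CARD('k) + 1\<close>; the finite index type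
  \<open>'k\<close> plays the role of \<open>{1, \<dots>, k}\<close>, and is nonempty, as every type is.
\<close>

datatype 'k hindex = E 'k | Ehat 'k | Z

lemma UNIV_hindex: "(UNIV :: 'k hindex set) = range E \<union> range Ehat \<union> {Z}"
proof -
  have "x \<in> range E \<union> range Ehat \<union> {Z}" for x :: "'k hindex" by (cases x) auto
  thus ?thesis by blast
qed

instance hindex :: (finite) finite
  by standard (simp add: UNIV_hindex)

lemma card_hindex: "CARD('k::finite hindex) = 2 * CARD('k) + 1"
proof -
  have "range E \<inter> range Ehat = ({} :: 'k hindex set)" by auto
  moreover have "Z \<notin> range E \<union> (range Ehat :: 'k hindex set)" by auto
  ultimately show ?thesis
    by (simp add: UNIV_hindex card_Un_disjoint card_image inj_on_def)
qed

type_synonym ('a, 'k) heis = "'a ^ 'k hindex"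

definition hbasis :: "'k::finite hindex \<Rightarrow> ('a::field, 'k) heis"
  where "hbasis b = axis b 1"

fun basis_bracket :: "'k::finite hindex \<Rightarrow> 'k hindex \<Rightarrow> ('a::field, 'k) heis" where
  "basis_bracket (E i) (Ehat j) = (if i = j then hbasis Z else 0)"
| "basis_bracket (Ehat i) (E j) = (if i = j then - hbasis Z else 0)"
| "basis_bracket _ _ = 0"

definition heis_bracket ::
  "('a::field, 'k::finite) heis \<Rightarrow> ('a, 'k) heis \<Rightarrow> ('a, 'k) heis"
  where "heis_bracket x y = (\<Sum>b\<in>UNIV. \<Sum>c\<in>UNIV. (x $ b * y $ c) *s basis_bracket b c)"

text \<open>The degrees lie in \<open>\<int>\<^sup>k \<times> \<int>\<close>.\<close>

fun hdeg :: "'k::finite hindex \<Rightarrow> (int ^ 'k) \<times> int" where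
  "hdeg (E i) = (axis i 1, 1)"
| "hdeg (Ehat i) = (- axis i 1, 1)"
| "hdeg Z = (0, 2)"

definition heis_grading :: "(int ^ 'k) \<times> int \<Rightarrow> ('a::field, 'k::finite) heis set"
  where "heis_grading g = vec.span {hbasis b | b. hdeg b = g}"

text \<open>The linear map with prescribed values \<open>v\<close> on the basis.\<close>

definition lin_ext ::
  "('k::finite hindex \<Rightarrow> ('a::field, 'k) heis) \<Rightarrow> ('a, 'k) heis \<Rightarrow> ('a, 'k) heis"
  where "lin_ext v x = (\<Sum>b\<in>UNIV. x $ b *s v b)"

definition perm_aut ::
  "('k::finite \<Rightarrow> 'k) \<Rightarrow> ('a::field, 'k) heis \<Rightarrow> ('a, 'k) heis"
  where "perm_aut \<sigma> = lin_ext (\<lambda>b. case b of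
      E i \<Rightarrow> hbasis (E (\<sigma> i))
    | Ehat i \<Rightarrow> hbasis (Ehat (\<sigma> i))
    | Z \<Rightarrow> hbasis Z)"

definition mu_aut :: "'k::finite \<Rightarrow> ('a::field, 'k) heis \<Rightarrow> ('a, 'k) heis"
  where "mu_aut i = lin_ext (\<lambda>b. case b of
      E j \<Rightarrow> if j = i then hbasis (Ehat j) else hbasis (E j)
    | Ehat j \<Rightarrow> if j = i then - hbasis (E j) else hbasis (Ehat j)
    | Z \<Rightarrow> hbasis Z)"

lemma lin_ext_hbasis: "lin_ext v (hbasis b) = v b"
proof -
  have "lin_ext v (hbasis b) = (\<Sum>c\<in>UNIV. if c = b then v c else 0)"
    unfolding lin_ext_def hbasis_def by (rule sum.cong) (auto simp: axis_def)
  thus ?thesis by simp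
qed

lemma heis_bracket_hbasis: "heis_bracket (hbasis b) (hbasis c) = basis_bracket b c"
proof -
  have "heis_bracket (hbasis b) (hbasis c)
      = (\<Sum>b'\<in>UNIV. \<Sum>c'\<in>UNIV. if c' = c then (if b' = b then basis_bracket b' c' else 0) else 0)"
    unfolding heis_bracket_def hbasis_def
    by (intro sum.cong refl) (auto simp: axis_def)
  thus ?thesis by simp
qed

lemma sum_hindex:
  "(\<Sum>b\<in>UNIV. f b) = (\<Sum>i\<in>UNIV. f (E i)) + (\<Sum>i\<in>UNIV. f (Ehat i)) + f Z"
  for f :: "'k::finite hindex \<Rightarrow> 'c::comm_monoid_add"
proof -
  have "(\<Sum>b\<in>UNIV. f b) = sum f (range E \<union> range Ehat) + f Z"
    unfolding UNIV_hindex by (subst sum.union_disjoint) auto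
  also have "sum f (range E \<union> range Ehat) = sum f (range E) + sum f (range Ehat)"
    by (rule sum.union_disjoint) auto
  finally show ?thesis by (simp add: sum.reindex inj_on_def)
qed

lemma heis_bracket_eq:
  "heis_bracket x y
    = (\<Sum>i\<in>UNIV. x $ E i * y $ Ehat i - x $ Ehat i * y $ E i) *s hbasis Z"
proof -
  have a: "(\<Sum>j\<in>UNIV. c j *s (if i = j then v else 0)) = c i *s v"
    for c :: "'b \<Rightarrow> 'a" and i v
  proof -
    have "(\<Sum>j\<in>UNIV. c j *s (if i = j then v else 0)) = (\<Sum>j\<in>UNIV. if i = j then c j *s v else 0)"
      by (rule sum.cong) auto
    thus ?thesis by simp
  qed
  show ?thesis
    unfolding heis_bracket_def
    by (simp add: sum_hindex a sum_subtractf vec.scale_left_diff_distrib vec.scale_sum_left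
        sum_negf)
qed

lemma heis_bracket_alternating: "heis_bracket x x = 0"
  by (simp add: heis_bracket_eq mult.commute)

lemma heis_bracket_nilpotent: "heis_bracket (heis_bracket x y) w = 0"
  by (simp add: heis_bracket_eq hbasis_def axis_def)

lemma heis_jacobi:
  "heis_bracket (heis_bracket x y) w + heis_bracket (heis_bracket y w) x
    + heis_bracket (heis_bracket w x) y = 0"
  by (simp add: heis_bracket_nilpotent)

text \<open>Distinct basis vectors have distinct degrees, so the homogeneous components are lines.\<close>

lemma inj_hdeg: "inj (hdeg :: 'k::finite hindex \<Rightarrow> _)"
proof (rule injI)
  have ax: "axis i 1 = (axis j 1 :: int ^ 'k) \<Longrightarrow> i = j" for i j :: 'k
    by (simp add: axis_eq_axis)
  have am: "axis i 1 \<noteq> (- axis j 1 :: int ^ 'k)" for i j :: 'k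
  proof
    assume "axis i 1 = (- axis j 1 :: int ^ 'k)"
    hence "(axis i 1 :: int ^ 'k) $ i = (- axis j 1 :: int ^ 'k) $ i" by simp
    thus False by (simp add: axis_def split: if_splits)
  qed
  fix b c :: "'k hindex" assume "hdeg b = hdeg c"
  thus "b = c" by (cases b; cases c) (auto simp: am am[symmetric] dest: ax)
qed

lemma heis_grading_hdeg: "heis_grading (hdeg b) = vec.span {hbasis b}"
proof -
  have "{hbasis c | c. hdeg c = hdeg b} = {hbasis b}" using inj_hdeg by (auto simp: inj_def)
  thus ?thesis unfolding heis_grading_def by (rule arg_cong)
qed

lemma heis_grading_outside: "g \<notin> range hdeg \<Longrightarrow> heis_grading g = {0}"
proof -
  assume "g \<notin> range hdeg"
  hence "{hbasis b | b. hdeg b = g} = {}" by auto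
  thus ?thesis by (simp add: heis_grading_def)
qed

lemma hom_components_heis:
  "hom_components (heis_grading :: _ \<Rightarrow> ('a::field, 'k::finite) heis set)
    = {vec.span {hbasis b} | b. True}"
proof -
  have nz: "vec.span {hbasis b :: ('a, 'k) heis} \<noteq> {0}" for b
  proof
    assume "vec.span {hbasis b :: ('a, 'k) heis} = {0}"
    hence "(hbasis b :: ('a, 'k) heis) = 0" using vec.span_base by blast
    thus False by (simp add: hbasis_def axis_eq_0_iff)
  qed
  have "S \<in> {vec.span {hbasis b} | b. True}"
    if S: "S \<in> hom_components (heis_grading :: _ \<Rightarrow> ('a, 'k) heis set)" for S
  proof -
    obtain g where g: "S = heis_grading g" "heis_grading g \<noteq> ({0} :: ('a, 'k) heis set)"
      using S by (auto simp: hom_components_def)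
    with heis_grading_outside obtain b where "g = hdeg b" by blast
    thus ?thesis using g(1) heis_grading_hdeg by auto
  qed
  moreover have "vec.span {hbasis b} \<in> hom_components (heis_grading :: _ \<Rightarrow> ('a, 'k) heis set)" for b
    unfolding hom_components_def
    by (rule CollectI, rule exI[of _ "hdeg b"]) (simp add: heis_grading_hdeg nz)
  ultimately show ?thesis by blast
qed

lemma heis_grading_bracket:
  fixes x y :: "('a::field, 'k::finite) heis"
  assumes "x \<in> heis_grading g" "y \<in> heis_grading h"
  shows "heis_bracket x y \<in> heis_grading (g + h)"
proof (cases "g \<in> range hdeg \<and> h \<in> range hdeg")
  case True
  then obtain b c where bc: "g = hdeg b" "h = hdeg c" by blast
  obtain r where r: "x = r *s hbasis b"
    using assms(1) by (auto simp: bc heis_grading_hdeg vec.span_singleton)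
  obtain s where s: "y = s *s hbasis c"
    using assms(2) by (auto simp: bc heis_grading_hdeg vec.span_singleton)
  have "heis_bracket x y = (r * s) *s heis_bracket (hbasis b) (hbasis c)"
    by (simp add: r s heis_bracket_eq vec.scale_sum_left[symmetric] sum_distrib_left
        algebra_simps)
  moreover have "(basis_bracket b c :: ('a, 'k) heis) \<in> heis_grading (g + h)"
  proof (cases "basis_bracket b c = (0 :: ('a, 'k) heis)")
    case True
    thus ?thesis by (simp add: heis_grading_def vec.span_zero)
  next
    case False
    hence d: "g + h = hdeg Z" and
      v: "basis_bracket b c = (hbasis Z :: ('a, 'k) heis) \<or> basis_bracket b c = (- hbasis Z :: ('a, 'k) heis)"
      by (cases b; cases c; auto simp: bc split: if_splits)+
    show ?thesis unfolding d heis_grading_hdeg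
      using v vec.span_base[of "hbasis Z :: ('a, 'k) heis" "{hbasis Z}"]
        vec.span_neg[of "hbasis Z :: ('a, 'k) heis" "{hbasis Z}"] by auto
  qed
  ultimately show ?thesis
    by (simp add: heis_bracket_hbasis heis_grading_def vec.span_scale)
next
  case False
  hence "x = 0 \<or> y = 0" using assms heis_grading_outside by blast
  hence "heis_bracket x y = 0" by (auto simp: heis_bracket_eq)
  thus ?thesis by (simp add: heis_grading_def vec.span_zero)
qed

end

theory Submission
  imports Defs
begin

text \<open>
  The homogeneous components are the lines spanned by the basis vectors, so an automorphism in
  \<open>Aut(\<Gamma>)\<close> sends each basis vector to a nonzero multiple of a basis vector: it is a monomial map
  with an underlying permutation \<open>p\<close> of the basis (\<open>heis_auts_is_monomial\<close>). Two automorphisms with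
  the same \<open>p\<close> differ by an element of \<open>Stab(\<Gamma>)\<close>, so \<open>p\<close> determines the class in the Weyl group
  (\<open>heis_class_eqI\<close>), and classes can be compared without regard to the scalars.

  The nonzero brackets of basis vectors are those of the pairs \<open>{E i, Ehat i}\<close>, and they all lie on the
  line of \<open>z\<close>. Hence \<open>p\<close> fixes \<open>z\<close> and permutes these pairs (\<open>heis_auts_permutation\<close>); within each pair
  it either keeps or exchanges the hatted and the unhatted vector. Thus \<open>p\<close> is a signed permutation.
  If no pair is exchanged, the class is that of some \<open>perm_aut \<sigma>\<close>. Composing with \<open>mu_aut i\<close>
  removes the exchange at the pair \<open>i\<close>, and as \<open>mu_aut i\<close> has order two modulo the stabilizer, the
  class is recovered by composing with \<open>mu_aut i\<close> again. Induction on the number of exchanged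
  pairs therefore writes every class with the \<open>perm_aut \<sigma>\<close> and all the \<open>mu_aut i\<close>
  (\<open>heis_class_in_closed_set\<close>). A single \<open>mu_aut i\<close> suffices, since a transposition conjugates it to
  any other (\<open>heis_class_mu_conj\<close>).
\<close>

abbreviation vec_linear :: "(('a::field ^ 'b::finite) \<Rightarrow> ('a ^ 'b)) \<Rightarrow> bool"
  where "vec_linear \<equiv> Vector_Spaces.linear (*s) (*s)"

section \<open>Automorphisms from their values on the basis\<close>

lemma vec_linear_scale: "vec_linear f \<Longrightarrow> f (a *s x) = a *s f x"
  by (simp add: Vector_Spaces.linear_iff)

lemma linear_sum_scale:
  assumes "vec_linear f"
  shows "f (\<Sum>b\<in>B. a b *s v b) = (\<Sum>b\<in>B. a b *s f (v b))"
proof -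
  interpret f: Vector_Spaces.linear "(*s)" "(*s)" f by (rule assms)
  show ?thesis by (simp add: f.sum f.scale)
qed

lemma hbasis_expansion: "(\<Sum>b\<in>UNIV. x $ b *s hbasis b) = x"
  unfolding hbasis_def by (rule basis_expansion)

lemma linear_expansion:
  assumes "vec_linear f"
  shows "f x = (\<Sum>b\<in>UNIV. x $ b *s f (hbasis b))"
  using linear_sum_scale[OF assms, of "\<lambda>b. x $ b" hbasis UNIV] by (simp add: hbasis_expansion)

lemma linear_lin_ext: "vec_linear (lin_ext v)"
  unfolding Vector_Spaces.linear_iff
  by (auto simp: lin_ext_def vec.scale_left_distrib sum.distrib vec.scale_sum_right
      vec.vector_space_axioms)

lemma heis_bracket_sum:
  "heis_bracket (\<Sum>b\<in>B. s b *s u b) (\<Sum>c\<in>C. t c *s w c)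
    = (\<Sum>b\<in>B. \<Sum>c\<in>C. (s b * t c) *s heis_bracket (u b) (w c))"
proof -
  have left: "heis_bracket (\<Sum>b\<in>B. s b *s u b) y = (\<Sum>b\<in>B. s b *s heis_bracket (u b) y)" for y
  proof -
    have "vec_linear (\<lambda>x. heis_bracket x y)"
      unfolding Vector_Spaces.linear_iff
      by (auto simp: heis_bracket_eq vec.vector_space_axioms vec.scale_left_distrib[symmetric]
          sum.distrib[symmetric] sum_distrib_left algebra_simps simp del: vec.scale_left_distrib)
    thus ?thesis by (rule linear_sum_scale)
  qed
  have right: "heis_bracket x (\<Sum>c\<in>C. t c *s w c) = (\<Sum>c\<in>C. t c *s heis_bracket x (w c))" for x
  proof -
    have "vec_linear (\<lambda>y. heis_bracket x y)"
      unfolding Vector_Spaces.linear_iff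
      by (auto simp: heis_bracket_eq vec.vector_space_axioms vec.scale_left_distrib[symmetric]
          sum.distrib[symmetric] sum_distrib_left algebra_simps simp del: vec.scale_left_distrib)
    thus ?thesis by (rule linear_sum_scale)
  qed
  show ?thesis
    unfolding left unfolding right by (simp add: vec.scale_sum_right mult.commute)
qed

lemma heis_bracket_scale:
  "heis_bracket (s *s x) (t *s y) = (s * t) *s heis_bracket x y"
  using heis_bracket_sum[of "\<lambda>_. s" "\<lambda>_. x" "{()}" "\<lambda>_. t" "\<lambda>_. y" "{()}"] by simp

lemma heis_bracket_minus:
  fixes x y :: "('a::field, 'k::finite) heis"
  shows "heis_bracket (- x) y = - heis_bracket x y" "heis_bracket x (- y) = - heis_bracket x y"
  using heis_bracket_scale[of "- 1" x 1 y] heis_bracket_scale[of 1 x "- 1" y] by simp_all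

text \<open>Bilinearity reduces the homomorphism property to the structure constants.\<close>

lemma hom_if_hom_on_basis:
  assumes lin: "vec_linear f"
    and basis: "\<And>b c. f (basis_bracket b c) = heis_bracket (f (hbasis b)) (f (hbasis c))"
  shows "f (heis_bracket x y) = heis_bracket (f x) (f y)"
proof -
  interpret f: Vector_Spaces.linear "(*s)" "(*s)" f by (rule lin)
  have "f (heis_bracket x y)
      = (\<Sum>b\<in>UNIV. \<Sum>c\<in>UNIV. (x $ b * y $ c) *s heis_bracket (f (hbasis b)) (f (hbasis c)))"
    unfolding heis_bracket_def by (simp add: f.sum f.scale basis heis_bracket_def)
  also have "\<dots> = heis_bracket (f x) (f y)"
    by (simp add: heis_bracket_sum linear_expansion[OF lin, of x] linear_expansion[OF lin, of y])
  finally show ?thesis .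
qed

section \<open>Monomial maps and their basis permutations\<close>

text \<open>
  The scalars may depend on the basis vector and are deliberately forgotten: only \<open>p\<close> matters for
  the class in the Weyl group.
\<close>

definition is_monomial ::
  "(('a::field, 'k::finite) heis \<Rightarrow> ('a, 'k) heis) \<Rightarrow> ('k hindex \<Rightarrow> 'k hindex) \<Rightarrow> bool"
  where "is_monomial f p \<longleftrightarrow> (\<forall>b. \<exists>a. a \<noteq> 0 \<and> f (hbasis b) = a *s hbasis (p b))"

lemma is_monomialE:
  assumes "is_monomial f p"
  obtains a where "a \<noteq> 0" "f (hbasis b) = a *s hbasis (p b)"
  using assms by (auto simp: is_monomial_def)

lemma hbasis_nth: "hbasis b $ c = (if c = b then 1 else 0)"
  by (simp add: hbasis_def axis_def)

lemma scale_hbasis_eqD: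
  assumes "s *s hbasis b = t *s hbasis c" "s \<noteq> 0"
  shows "b = c"
  using arg_cong[OF assms(1), of "\<lambda>x. x $ b"] assms(2) by (simp add: hbasis_nth split: if_splits)

lemma is_monomial_comp:
  assumes "vec_linear f" "is_monomial f p" "is_monomial h q"
  shows "is_monomial (f \<circ> h) (p \<circ> q)"
  unfolding is_monomial_def
proof
  fix b
  obtain s where s: "s \<noteq> 0" "h (hbasis b) = s *s hbasis (q b)" using assms(3) by (rule is_monomialE)
  obtain t where t: "t \<noteq> 0" "f (hbasis (q b)) = t *s hbasis (p (q b))" using assms(2) by (rule is_monomialE)
  have "(f \<circ> h) (hbasis b) = (s * t) *s hbasis ((p \<circ> q) b)"
    by (simp add: s t vec_linear_scale[OF assms(1)])
  with s t show "\<exists>a. a \<noteq> 0 \<and> (f \<circ> h) (hbasis b) = a *s hbasis ((p \<circ> q) b)"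
    by (metis mult_eq_0_iff)
qed

lemma is_monomial_span:
  assumes "vec_linear f" "is_monomial f p"
  shows "f ` vec.span {hbasis b} = vec.span {hbasis (p b)}"
proof -
  obtain a where a: "a \<noteq> 0" "f (hbasis b) = a *s hbasis (p b)" using assms(2) by (rule is_monomialE)
  interpret f: Vector_Spaces.linear "(*s)" "(*s)" f by (rule assms(1))
  have fwd: "f (t *s hbasis b) = (t * a) *s hbasis (p b)" for t
    using a by (simp add: f.scale)
  have surj: "range (\<lambda>t. t * a) = UNIV"
    by (rule surjI[of _ "\<lambda>t. t / a"]) (simp add: a(1))
  have "f ` vec.span {hbasis b} = (\<lambda>t. t *s hbasis (p b)) ` range (\<lambda>t. t * a)"
    by (simp only: vec.span_singleton image_image fwd)
  thus ?thesis by (simp only: surj vec.span_singleton)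
qed

text \<open>
  The coordinate of \<open>f x\<close> at \<open>p b\<close> is a nonzero multiple of the coordinate of \<open>x\<close> at \<open>b\<close>, so \<open>f x\<close>
  determines \<open>x\<close>; surjectivity then comes from the finite dimension.
\<close>

lemma is_monomial_bij:
  fixes f :: "('a::field, 'k::finite) heis \<Rightarrow> ('a, 'k) heis"
  assumes lin: "vec_linear f" and mon: "is_monomial f p" and inj: "inj p"
  shows "bij f"
proof -
  obtain a where a: "\<And>b. a b \<noteq> 0" "\<And>b. f (hbasis b) = a b *s hbasis (p b)"
    using mon unfolding is_monomial_def by metis
  have coord: "f x $ p b = x $ b * a b" for x b
  proof -
    have "f x $ p b = (\<Sum>c\<in>UNIV. if c = b then x $ c * a c else 0)"
      using inj by (subst linear_expansion[OF lin], simp only: a sum_component)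
        (rule sum.cong, auto simp: hbasis_nth inj_eq)
    thus ?thesis by simp
  qed
  have "inj f"
  proof (rule injI)
    fix x y assume eq: "f x = f y"
    have "x $ b = y $ b" for b using coord[of x b] coord[of y b] a(1)[of b] eq by simp
    thus "x = y" by (simp add: vec_eq_iff)
  qed
  thus ?thesis using vec.linear_inj_imp_surj[OF lin] by (simp add: bij_def)
qed

text \<open>If two lines had the same image, suitable multiples of their generators would too.\<close>

lemma is_monomial_inj:
  assumes lin: "vec_linear f" and bij: "bij f" and mon: "is_monomial f p"
  shows "inj p"
proof (rule injI)
  fix b c assume eq: "p b = p c"
  obtain s where s: "s \<noteq> 0" "f (hbasis b) = s *s hbasis (p b)" using mon by (rule is_monomialE)
  obtain t where t: "t \<noteq> 0" "f (hbasis c) = t *s hbasis (p c)" using mon by (rule is_monomialE)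
  \<comment> \<open>The factors are crossed so that both images become \<open>s * t\<close> times the same basis vector.\<close>
  have "f (t *s hbasis b) = f (s *s hbasis c)"
    by (simp add: vec_linear_scale[OF lin] s t eq mult.commute)
  hence "t *s hbasis b = s *s hbasis c" using bij by (simp add: bij_is_inj inj_eq)
  thus "b = c" using t(1) by (rule scale_hbasis_eqD)
qed

abbreviation heis_auts :: "(('a::field, 'k::finite) heis \<Rightarrow> ('a, 'k) heis) set"
  where "heis_auts \<equiv> aut_grading heis_bracket heis_grading"

lemma heis_autsD:
  assumes "f \<in> heis_auts"
  shows "vec_linear f" "bij f" "f (heis_bracket x y) = heis_bracket (f x) (f y)"
  using assms by (auto simp: aut_grading_def alg_auts_def)

text \<open>
  A linear monomial map with injective \<open>p\<close> permutes the homogeneous components, so membership in \<open>Aut(\<Gamma>)\<close>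
  comes down to a finite check of brackets of basis vectors.
\<close>

lemma is_monomial_imp_heis_auts:
  fixes f :: "('a::field, 'k::finite) heis \<Rightarrow> ('a, 'k) heis"
  assumes lin: "vec_linear f" and mon: "is_monomial f p" and inj: "inj p"
    and basis: "\<And>b c. f (basis_bracket b c) = heis_bracket (f (hbasis b)) (f (hbasis c))"
  shows "f \<in> heis_auts"
proof -
  have bij: "bij f" using lin mon inj by (rule is_monomial_bij)
  have "surj p" using inj by (simp add: finite_UNIV_inj_surj)
  have "(`) f ` range (\<lambda>b. vec.span {hbasis b}) = (\<lambda>c. vec.span {hbasis c}) ` range p"
    by (simp only: image_image is_monomial_span[OF lin mon])
  hence "(`) f ` range (\<lambda>b. vec.span {hbasis b}) = range (\<lambda>b. vec.span {hbasis b})"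
    by (simp only: \<open>surj p\<close>)
  moreover have "inj_on ((`) f) A" for A
    using bij by (auto intro: inj_onI simp: bij_is_inj inj_image_eq_iff)
  ultimately show ?thesis
    using lin bij hom_if_hom_on_basis[OF lin basis]
    by (simp add: aut_grading_def alg_auts_def hom_components_heis full_SetCompr_eq bij_betw_def)
qed

text \<open>
  This is where the grading enters: its components are exactly the lines of the basis vectors, so
  permuting components means permuting these lines.
\<close>

lemma heis_auts_is_monomial:
  fixes f :: "('a::field, 'k::finite) heis \<Rightarrow> ('a, 'k) heis"
  assumes "f \<in> heis_auts"
  obtains p where "is_monomial f p"
proof -
  note f = heis_autsD[OF assms]
  interpret f: Vector_Spaces.linear "(*s)" "(*s)" f by (rule f(1))
  have "\<exists>c a. a \<noteq> 0 \<and> f (hbasis b) = a *s hbasis c" for b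
  proof -
    have "f ` vec.span {hbasis b} \<in> hom_components heis_grading"
      using assms by (auto simp: aut_grading_def hom_components_heis dest!: bij_betwE)
    then obtain c where "f ` vec.span {hbasis b} = vec.span {hbasis c}"
      by (auto simp: hom_components_heis)
    moreover have "f (hbasis b) \<in> f ` vec.span {hbasis b}" by (simp add: vec.span_base)
    ultimately obtain a where a: "f (hbasis b) = a *s hbasis c"
      by (auto simp: vec.span_singleton)
    have "hbasis b \<noteq> (0 :: ('a, 'k) heis)" by (simp add: hbasis_def axis_eq_0_iff)
    hence "f (hbasis b) \<noteq> f 0" using f(2) by (metis bij_is_inj injD)
    hence "a \<noteq> 0" using a f.zero by auto
    with a show ?thesis by blast
  qed
  then show ?thesis using that unfolding is_monomial_def by metis
qed

section \<open>Signed permutations\<close>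

fun index_perm :: "('k \<Rightarrow> 'k) \<Rightarrow> 'k hindex \<Rightarrow> 'k hindex" where
  "index_perm \<sigma> (E i) = E (\<sigma> i)"
| "index_perm \<sigma> (Ehat i) = Ehat (\<sigma> i)"
| "index_perm \<sigma> Z = Z"

fun index_swap :: "'k \<Rightarrow> 'k hindex \<Rightarrow> 'k hindex" where
  "index_swap i (E j) = (if j = i then Ehat j else E j)"
| "index_swap i (Ehat j) = (if j = i then E j else Ehat j)"
| "index_swap i Z = Z"

lemma index_swap_swap: "index_swap i (index_swap i b) = b"
  by (cases b) auto

lemma perm_aut_hbasis: "perm_aut \<sigma> (hbasis b) = hbasis (index_perm \<sigma> b)"
  by (cases b) (simp_all add: perm_aut_def lin_ext_hbasis)

lemma mu_aut_hbasis:
  "mu_aut i (hbasis b) = (if b = Ehat i then - hbasis (E i) else hbasis (index_swap i b))"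
  by (cases b) (simp_all add: mu_aut_def lin_ext_hbasis)

lemma is_monomial_perm_aut: "is_monomial (perm_aut \<sigma>) (index_perm \<sigma>)"
  unfolding is_monomial_def
  by (auto intro!: exI[of _ 1] simp: perm_aut_hbasis)

lemma is_monomial_mu_aut: "is_monomial (mu_aut i) (index_swap i)"
  unfolding is_monomial_def
proof
  fix b
  show "\<exists>a. a \<noteq> 0 \<and> mu_aut i (hbasis b) = a *s hbasis (index_swap i b)"
    by (rule exI[of _ "if b = Ehat i then - 1 else 1"]) (simp add: mu_aut_hbasis)
qed

lemma perm_aut_in_heis_auts:
  assumes "inj \<sigma>"
  shows "perm_aut \<sigma> \<in> heis_auts"
proof (rule is_monomial_imp_heis_auts[OF _ is_monomial_perm_aut])
  show lin: "vec_linear (perm_aut \<sigma>)" unfolding perm_aut_def by (rule linear_lin_ext)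
  interpret f: Vector_Spaces.linear "(*s)" "(*s)" "perm_aut \<sigma>" by (rule lin)
  have "b = c" if "index_perm \<sigma> b = index_perm \<sigma> c" for b c
    using that assms by (cases b; cases c) (auto simp: inj_eq)
  thus "inj (index_perm \<sigma>)" by (rule injI)
  show "perm_aut \<sigma> (basis_bracket b c) = heis_bracket (perm_aut \<sigma> (hbasis b)) (perm_aut \<sigma> (hbasis c))" for b c
    using assms by (cases b; cases c;
      auto simp: perm_aut_hbasis heis_bracket_hbasis f.zero f.neg inj_eq)
qed

lemma mu_aut_in_heis_auts:
  fixes i :: "'k::finite"
  shows "(mu_aut i :: ('a::field, 'k) heis \<Rightarrow> _) \<in> heis_auts"
proof (rule is_monomial_imp_heis_auts[OF _ is_monomial_mu_aut])
  show lin: "vec_linear (mu_aut i)" unfolding mu_aut_def by (rule linear_lin_ext)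
  interpret f: Vector_Spaces.linear "(*s)" "(*s)" "mu_aut i" by (rule lin)
  show "inj (index_swap i)" by (rule injI) (metis index_swap_swap)
  show "mu_aut i (basis_bracket b c) = heis_bracket (mu_aut i (hbasis b)) (mu_aut i (hbasis c))" for b c
    by (cases b; cases c; auto simp: mu_aut_hbasis heis_bracket_hbasis heis_bracket_minus f.zero f.neg)
qed

lemma basis_bracket_neq_0D:
  assumes "basis_bracket b c \<noteq> 0"
  shows "\<exists>j. b = E j \<and> c = Ehat j \<or> b = Ehat j \<and> c = E j"
  using assms by (cases b; cases c) (auto split: if_splits)

lemma basis_bracket_multiple: "\<exists>t. basis_bracket b c = t *s hbasis Z"
proof (cases "basis_bracket b c = (0 :: ('a::field, 'b::finite) heis)")
  case True
  thus ?thesis by (intro exI[of _ 0]) simp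
next
  case False
  then obtain j where "b = E j \<and> c = Ehat j \<or> b = Ehat j \<and> c = E j"
    using basis_bracket_neq_0D by blast
  thus ?thesis by (auto intro: exI[of _ 1] exI[of _ "- 1"])
qed

text \<open>
  Apply \<open>f\<close> to \<open>heis_bracket (hbasis (E i)) (hbasis (Ehat i)) = hbasis Z\<close>: the bracket of the
  images is a nonzero multiple of \<open>hbasis (p Z)\<close>. Being a bracket, it also lies on the line of
  \<open>hbasis Z\<close>, whence \<open>p Z = Z\<close>; being nonzero, it can only come from two partners.
\<close>

lemma heis_auts_permutation:
  fixes f :: "('a::field, 'k::finite) heis \<Rightarrow> ('a, 'k) heis"
  assumes aut: "f \<in> heis_auts" and mon: "is_monomial f p"
  shows "p Z = Z"
    and "\<exists>j. p (E i) = E j \<and> p (Ehat i) = Ehat j \<or> p (E i) = Ehat j \<and> p (Ehat i) = E j"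
proof -
  note f = heis_autsD[OF aut]
  have main: "p Z = Z \<and> basis_bracket (p (E i)) (p (Ehat i)) \<noteq> (0 :: ('a, 'k) heis)" for i
  proof -
    obtain s where s: "s \<noteq> 0" "f (hbasis (E i)) = s *s hbasis (p (E i))"
      using mon by (rule is_monomialE)
    obtain t where t: "t \<noteq> 0" "f (hbasis (Ehat i)) = t *s hbasis (p (Ehat i))"
      using mon by (rule is_monomialE)
    obtain u where u: "u \<noteq> 0" "f (hbasis Z) = u *s hbasis (p Z)" using mon by (rule is_monomialE)
    have eq: "u *s hbasis (p Z) = (s * t) *s basis_bracket (p (E i)) (p (Ehat i))"
      using f(3)[of "hbasis (E i)" "hbasis (Ehat i)"]
      by (simp add: heis_bracket_hbasis heis_bracket_scale s t u)
    obtain r where "basis_bracket (p (E i)) (p (Ehat i)) = r *s (hbasis Z :: ('a, 'k) heis)"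
      using basis_bracket_multiple by blast
    hence "u *s hbasis (p Z) = (s * t * r) *s (hbasis Z :: ('a, 'k) heis)" using eq by simp
    hence "p Z = Z" using u(1) by (rule scale_hbasis_eqD)
    moreover have "u *s hbasis (p Z) \<noteq> (0 :: ('a, 'k) heis)"
      using u(1) by (simp add: hbasis_def axis_eq_0_iff)
    ultimately show ?thesis using eq by auto
  qed
  show "p Z = Z" using main by blast
  show "\<exists>j. p (E i) = E j \<and> p (Ehat i) = Ehat j \<or> p (E i) = Ehat j \<and> p (Ehat i) = E j"
    using main[of i] basis_bracket_neq_0D by blast
qed

section \<open>Classes in the Weyl group and their generation\<close>

abbreviation heis_weyl :: "(('a::field, 'k::finite) heis \<Rightarrow> ('a, 'k) heis) set monoid"
  where "heis_weyl \<equiv> weyl_group heis_bracket heis_grading"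

abbreviation heis_class :: "(('a::field, 'k::finite) heis \<Rightarrow> ('a, 'k) heis)
    \<Rightarrow> (('a, 'k) heis \<Rightarrow> ('a, 'k) heis) set"
  where "heis_class \<equiv> weyl_class heis_bracket heis_grading"

lemma carrier_aut_group: "carrier (aut_group br \<Gamma>) = aut_grading br \<Gamma>"
  by (simp add: aut_group_def)

lemma carrier_weyl_group: "carrier (weyl_group br \<Gamma>) = weyl_class br \<Gamma> ` aut_grading br \<Gamma>"
  by (auto simp: weyl_group_def weyl_class_def FactGroup_def RCOSETS_def carrier_aut_group)

lemma aut_grading_comp:
  assumes "f \<in> aut_grading br \<Gamma>" "h \<in> aut_grading br \<Gamma>"
  shows "f \<circ> h \<in> aut_grading br \<Gamma>"
  using group.is_monoid[OF group_aut_group, THEN monoid.m_closed, of f br \<Gamma> h] assms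
  by (simp add: carrier_aut_group mult_aut_group aut_grading_bij)

lemma weyl_class_comp:
  assumes "f \<in> aut_grading br \<Gamma>" "h \<in> aut_grading br \<Gamma>"
  shows "weyl_class br \<Gamma> (f \<circ> h) = weyl_class br \<Gamma> f \<otimes>\<^bsub>weyl_group br \<Gamma>\<^esub> weyl_class br \<Gamma> h"
  using normal.rcos_sum[OF stab_normal, of f br \<Gamma> h] assms
  by (simp add: weyl_group_def weyl_class_def FactGroup_def carrier_aut_group mult_aut_group
      aut_grading_bij)

text \<open>
  The quotient \<open>f \<circ> h\<^sup>-\<^sup>1\<close> maps the line of \<open>p b\<close> back to \<open>b\<close> and forth to \<open>p b\<close>. Since \<open>p\<close> reaches every
  basis index, all components are invariant and the quotient lies in the stabilizer.
\<close>

lemma heis_class_eqI: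
  fixes f h :: "('a::field, 'k::finite) heis \<Rightarrow> ('a, 'k) heis"
  assumes f: "f \<in> heis_auts" and h: "h \<in> heis_auts"
    and mf: "is_monomial f p" and mh: "is_monomial h p"
  shows "heis_class f = heis_class h"
proof -
  note fD = heis_autsD[OF f] and hD = heis_autsD[OF h]
  let ?s = "f \<circ> inv_into UNIV h"
  have alg: "?s \<in> alg_auts heis_bracket"
    using f h by (simp add: aut_grading_def comp_alg_auts inv_alg_auts)
  have surj: "surj p"
    using is_monomial_inj[OF fD(1,2) mf] by (simp add: finite_UNIV_inj_surj)
  have "?s ` heis_grading g = heis_grading g" for g
  proof (cases "g \<in> range hdeg")
    case True
    then obtain c where c: "g = hdeg c" by blast
    obtain b where b: "c = p b" using surj by blast
    have "?s ` vec.span {hbasis (p b)} = f ` (inv_into UNIV h ` (h ` vec.span {hbasis b}))"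
      by (simp only: is_monomial_span[OF hD(1) mh] image_comp)
    also have "\<dots> = vec.span {hbasis (p b)}"
      using hD(2) by (simp only: image_inv_f_f bij_is_inj is_monomial_span[OF fD(1) mf])
    finally show ?thesis by (simp only: c b heis_grading_hdeg)
  next
    case False
    interpret s: Vector_Spaces.linear "(*s)" "(*s)" ?s using alg by (simp add: alg_auts_def)
    show ?thesis using s.zero by (simp add: heis_grading_outside[OF False])
  qed
  hence s: "?s \<in> stab_grading heis_bracket heis_grading" using alg by (simp add: stab_grading_def)
  have "?s \<circ> h = f" using hD(2) by (simp add: comp_assoc bij_is_inj)
  moreover have "bij ?s" using alg by (simp add: alg_auts_def)
  ultimately have "f = ?s \<otimes>\<^bsub>aut_group heis_bracket heis_grading\<^esub> h"
    using hD(2) by (simp add: mult_aut_group)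
  hence "f \<in> heis_class h" using s unfolding weyl_class_def r_coset_def by blast
  hence "heis_class h = heis_class f"
    unfolding weyl_class_def
    using h normal_imp_subgroup[OF stab_normal]
    by (intro group.repr_independence[OF group_aut_group]) (simp_all add: carrier_aut_group)
  thus ?thesis by simp
qed

text \<open>
  As \<open>mu_aut i\<close> squares to \<open>-1\<close> on the pair \<open>i\<close>, its class is an involution although \<open>mu_aut i\<close>
  need not be one.
\<close>

lemma heis_class_mu_mu:
  assumes "f \<in> heis_auts"
  shows "heis_class ((f \<circ> mu_aut i) \<circ> mu_aut i) = heis_class f"
proof -
  obtain p where p: "is_monomial f p" using heis_auts_is_monomial[OF assms] .
  note fmu = aut_grading_comp[OF assms mu_aut_in_heis_auts[of i]]
  have "is_monomial ((f \<circ> mu_aut i) \<circ> mu_aut i) ((p \<circ> index_swap i) \<circ> index_swap i)"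
    using assms fmu p by (intro is_monomial_comp is_monomial_mu_aut heis_autsD(1))
  moreover have "(p \<circ> index_swap i) \<circ> index_swap i = p" by (auto simp: index_swap_swap)
  ultimately show ?thesis
    using heis_class_eqI[OF aut_grading_comp[OF fmu mu_aut_in_heis_auts[of i]] assms _ p] by simp
qed

text \<open>
  A transposition is its own inverse, so the left-hand side is the class of a conjugate of
  \<open>mu_aut i\<close>.
\<close>

lemma heis_class_mu_conj:
  "heis_class ((perm_aut (Transposition.transpose i j) \<circ> mu_aut i)
      \<circ> perm_aut (Transposition.transpose i j)) = heis_class (mu_aut j)"
proof -
  let ?t = "perm_aut (Transposition.transpose i j)"
  let ?\<tau> = "index_perm (Transposition.transpose i j)"
  have t: "?t \<in> heis_auts" by (rule perm_aut_in_heis_auts) simp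
  note m = mu_aut_in_heis_auts
  have "is_monomial ((?t \<circ> mu_aut i) \<circ> ?t)
      ((?\<tau> \<circ> index_swap i) \<circ> ?\<tau>)"
    using t m aut_grading_comp[OF t m]
    by (intro is_monomial_comp is_monomial_mu_aut is_monomial_perm_aut heis_autsD(1))
  moreover have "((?\<tau> \<circ> index_swap i) \<circ> ?\<tau>) b
      = index_swap j b" for b
    by (cases b) (auto simp: Transposition.transpose_def)
  hence "(?\<tau> \<circ> index_swap i) \<circ> ?\<tau> = index_swap j"
    by (rule ext)
  ultimately show ?thesis
    using heis_class_eqI[OF aut_grading_comp[OF aut_grading_comp[OF t m] t] m _ is_monomial_mu_aut]
    by simp
qed

text \<open>
  The induction measure counts the exchanged pairs of the signed permutation. Undoing one exchange
  with \<open>mu_aut i\<close> lowers it, and the involution property turns the product back into \<open>f\<close>, so closure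
  of \<open>S\<close> under products is enough.
\<close>

lemma heis_class_in_closed_set:
  fixes f :: "('a::field, 'k::finite) heis \<Rightarrow> ('a, 'k) heis"
  assumes perm: "\<And>\<sigma> :: 'k \<Rightarrow> 'k. inj \<sigma> \<Longrightarrow> heis_class (perm_aut \<sigma> :: ('a, 'k) heis \<Rightarrow> _) \<in> S"
    and mu: "\<And>i :: 'k. heis_class (mu_aut i :: ('a, 'k) heis \<Rightarrow> _) \<in> S"
    and closed: "\<And>x y. x \<in> S \<Longrightarrow> y \<in> S \<Longrightarrow> x \<otimes>\<^bsub>heis_weyl\<^esub> y \<in> S"
    and f: "f \<in> heis_auts" and p: "is_monomial f p"
  shows "heis_class f \<in> S"
  using f p
proof (induction "card {i. \<exists>j. p (E i) = Ehat j}" arbitrary: f p rule: less_induct)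
  case less
  note f = less.prems(1) and mon = less.prems(2)
  note p = heis_auts_permutation[OF f mon]
  show ?case
  proof (cases "{i. \<exists>j. p (E i) = Ehat j} = {}")
    case True
    have "\<exists>j. p (E i) = E j \<and> p (Ehat i) = Ehat j" for i using p(2)[of i] True by blast
    then obtain \<sigma> where \<sigma>: "\<And>i. p (E i) = E (\<sigma> i)" "\<And>i. p (Ehat i) = Ehat (\<sigma> i)" by metis
    have "p b = index_perm \<sigma> b" for b by (cases b) (simp_all add: \<sigma> p(1))
    hence pe: "p = index_perm \<sigma>" by (rule ext)
    have "inj p" using heis_autsD[OF f] mon by (intro is_monomial_inj)
    hence "inj \<sigma>" using \<sigma>(1) by (intro injI) (metis hindex.inject(1) injD)
    hence "heis_class f = heis_class (perm_aut \<sigma>)"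
      using heis_class_eqI[OF f perm_aut_in_heis_auts mon] is_monomial_perm_aut pe by blast
    thus ?thesis using perm[OF \<open>inj \<sigma>\<close>] by simp
  next
    case False
    then obtain i j where ij: "p (E i) = Ehat j" by blast
    let ?q = "p \<circ> index_swap i"
    \<comment> \<open>The partner of an exchanged vector is exchanged too, so \<open>E i\<close> has an unhatted image under \<open>?q\<close>.\<close>
    have "\<nexists>j. p (Ehat i) = Ehat j" using p(2)[of i] ij by auto
    hence "{l. \<exists>j. ?q (E l) = Ehat j} = {l. \<exists>j. p (E l) = Ehat j} - {i}" by auto
    hence card: "card {l. \<exists>j. ?q (E l) = Ehat j} < card {l. \<exists>j. p (E l) = Ehat j}"
      using ij by (simp only:) (rule card_Diff1_less, auto)
    have aut: "f \<circ> mu_aut i \<in> heis_auts" using f mu_aut_in_heis_auts by (rule aut_grading_comp)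
    have "is_monomial (f \<circ> mu_aut i) ?q"
      using heis_autsD(1)[OF f] mon is_monomial_mu_aut by (rule is_monomial_comp)
    hence "heis_class (f \<circ> mu_aut i) \<in> S" using less.hyps[OF card aut] by blast
    hence "heis_class ((f \<circ> mu_aut i) \<circ> mu_aut i) \<in> S"
      unfolding weyl_class_comp[OF aut mu_aut_in_heis_auts] by (rule closed) (rule mu)
    thus ?thesis by (simp only: heis_class_mu_mu[OF f])
  qed
qed

theorem proposition1:
  fixes i1 :: "'k::finite"
    and br :: "('a::field, 'k) heis \<Rightarrow> ('a, 'k) heis \<Rightarrow> ('a, 'k) heis"
    and \<Gamma> :: "(int ^ 'k) \<times> int \<Rightarrow> ('a, 'k) heis set"
  defines "br \<equiv> heis_bracket"
    and "\<Gamma> \<equiv> heis_grading"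
  shows "generate (weyl_group br \<Gamma>)
      ({weyl_class br \<Gamma> (perm_aut \<sigma>) | \<sigma>. \<sigma> permutes UNIV} \<union> {weyl_class br \<Gamma> (mu_aut i1)})
    = carrier (weyl_group br \<Gamma>)"
  unfolding br_def \<Gamma>_def
proof
  let ?gens = "{heis_class (perm_aut \<sigma> :: ('a, 'k) heis \<Rightarrow> _) | \<sigma>. \<sigma> permutes UNIV}
    \<union> {heis_class (mu_aut i1)}"
  let ?S = "generate heis_weyl ?gens"
  have "?gens \<subseteq> carrier heis_weyl"
    by (auto simp: carrier_weyl_group mu_aut_in_heis_auts
        intro!: imageI perm_aut_in_heis_auts permutes_inj)
  thus "?S \<subseteq> carrier heis_weyl"
    using group.generate_incl[OF group_weyl_group] by blast
  have closed: "x \<otimes>\<^bsub>heis_weyl\<^esub> y \<in> ?S" if "x \<in> ?S" "y \<in> ?S" for x y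
    using that by (rule generate.eng)
  have perm: "heis_class (perm_aut \<sigma>) \<in> ?S" if "inj \<sigma>" for \<sigma> :: "'k \<Rightarrow> 'k"
  proof -
    have "\<sigma> permutes UNIV"
      using that by (intro bij_imp_permutes) (simp_all add: bij_def finite_UNIV_inj_surj)
    thus ?thesis by (intro generate.incl) blast
  qed
  have mu: "heis_class (mu_aut j) \<in> ?S" for j :: 'k
  proof -
    let ?t = "perm_aut (Transposition.transpose i1 j) :: ('a, 'k) heis \<Rightarrow> _"
    have t: "?t \<in> heis_auts" by (rule perm_aut_in_heis_auts) simp
    note m = mu_aut_in_heis_auts
    have "heis_class (mu_aut i1) \<in> ?S" by (intro generate.incl) blast
    hence "heis_class ((?t \<circ> mu_aut i1) \<circ> ?t) \<in> ?S"
      unfolding weyl_class_comp[OF aut_grading_comp[OF t m] t] weyl_class_comp[OF t m]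
      by (intro closed perm) simp_all
    thus ?thesis by (simp only: heis_class_mu_conj)
  qed
  show "carrier heis_weyl \<subseteq> ?S"
  proof
    fix x :: "(('a, 'k) heis \<Rightarrow> ('a, 'k) heis) set" assume "x \<in> carrier heis_weyl"
    then obtain f where f: "f \<in> heis_auts" and x: "x = heis_class f"
      by (auto simp: carrier_weyl_group)
    obtain p where p: "is_monomial f p" using heis_auts_is_monomial[OF f] .
    show "x \<in> ?S"
      unfolding x
      by (rule heis_class_in_closed_set[OF _ _ _ f p]) (erule perm, rule mu, erule (1) closed)
  qed
qed

end
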